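(* Let $\sigma$ be a signature, $\Gamma\subseteq\mathcal{L}(\sigma)$ and $\phi\in\mathcal{L}(\sigma)$. If $\Gamma\vdash\phi$ in $\mathsf{FOFS}$, then $\Gamma\Vdash\phi$.
   Context: Syntax. A signature $\sigma=(\sigma^\nu,\sigma^\pi,\sigma^\alpha)$ consists of a countably infinite set $\sigma^\nu$ of constants, a countable set $\sigma^\pi$ of predicate symbols, and an arity map $\sigma^\alpha:\sigma^\pi\to\mathbb{N}_{>0}$. Fix a countably infinite set $V$ of variables; terms are constants or variables. Formulas: $\phi::=P(t_1,\dots,t_n)\mid s\doteq t\mid(\phi\land\phi)\mid(\phi\lor\phi)\mid(\phi\to\phi)\mid\Box\phi\mid\Diamond\phi\mid\forall x\phi\mid\exists x\phi\mid\bot$ with $n=\sigma^\alpha(P)$; $\neg\phi:=\phi\to\bot$, $\top:=\neg\bot$, $\leftrightarrow$ as usual. A sentence has no free variables; $\mathcal{L}(\sigma)$ is the set of sentences. For a one-place formula $\phi$ (exactly one free variable), $\phi(t)$ substitutes $t$ for it. The Hilbert system $\mathsf{FOFS}$ ($\phi,\psi$ sentences unless noted, $c,c_1,c_2$ constants): axioms are all substitution instances of theorems of intuitionistic propositional logic; $\Box(\phi\land\psi)\leftrightarrow(\Box\phi\land\Box\psi)$; $\Box\top$; $\Diamond(\phi\lor\psi)\leftrightarrow(\Diamond\phi\lor\Diamond\psi)$; $\neg\Diamond\bot$; $(\Diamond\phi\to\Box\psi)\to\Box(\phi\to\psi)$; $\Diamond(\phi\to\psi)\to(\Box\phi\to\Diamond\psi)$;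 $\forall x\phi(x)\to\phi(c)$; $\phi(c)\to\exists x\phi(x)$; $\forall x(\phi(x)\to\psi)\to(\exists x\phi(x)\to\psi)$ ($\phi$ one-place); $\forall x(\phi\to\psi(x))\to(\phi\to\forall x\psi(x))$ ($\psi$ one-place); $c\doteq c$; $c_1\doteq c_2\to(\phi(c_1)\to\phi(c_2))$ for modal-free one-place $\phi$. Rules: modus ponens; from $\phi(c)$ infer $\forall x\phi(x)$ ($x$ substitutable for $c$); from $\phi\to\psi$ infer $\Box\phi\to\Box\psi$ and $\Diamond\phi\to\Diamond\psi$. $\Gamma\vdash\phi$ means $\vdash\bigwedge_i\gamma_i\to\phi$ for some finite $\{\gamma_i\}\subseteq\Gamma$. Semantics. A Fischer Servi frame $(W,\preccurlyeq,R)$: $\preccurlyeq$ a partial order, $R$ a binary relation, with (FC1) $wRv$, $v\preccurlyeq v'$ imply some $w'$ with $w\preccurlyeq w'$, $w'Rv'$; (FC2) $w\preccurlyeq w'$, $wRv$ imply some $v'$ with $v\preccurlyeq v'$, $w'Rv'$. A domain system gives sets $D(w)$ with $D(w)\subseteq D(w')$ when $w\preccurlyeq w'$ or $wRw'$, and equivalence relations $\sim_w$ on $D(w)$ with $a\sim_w b$, $w\preccurlyeq w'$ implying $a\sim_{w'}b$. An $\mathsf{FOFS}$ model adds $I(c)\in\bigcap_w D(w)$ for constants and $I_w(P)\subseteq D(w)^n$ for $n$-ary $P$, monotone along $\preccurlyeq$ and closed under componentwise $\sim_w$. For $g:V\to D(w)$: atomic clauses via $I_w$ and $\sim_w$; $\land,\lor$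 pointwise; $w\Vdash_g\phi\to\psi$ iff for all $w'\succcurlyeq w$, $w'\nVdash_g\phi$ or $w'\Vdash_g\psi$; $w\Vdash_g\Box\phi$ iff for all $w'\succcurlyeq w$ and $v'$ with $w'Rv'$, $v'\Vdash_g\phi$; $w\Vdash_g\Diamond\phi$ iff some $v$ with $wRv$ has $v\Vdash_g\phi$; $w\Vdash_g\forall x\phi$ iff for all $w'\succcurlyeq w$ and $a\in D(w')$, $w'\Vdash_{g[x:=a]}\phi$; $w\Vdash_g\exists x\phi$ iff some $a\in D(w)$ gives $w\Vdash_{g[x:=a]}\phi$; $\bot$ never holds. For sentences truth is independent of $g$. $\Gamma\Vdash\phi$ means every model--world pair satisfying all of $\Gamma$ satisfies $\phi$. *)

theory Defs
  imports Main "HOL-Library.Countable_Set"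
begin

section \<open>Syntax\<close>

record ('c, 'p) signature =
  sig_cst :: "'c set"
  sig_prd :: "'p set"
  sig_ar :: "'p \<Rightarrow> nat"

definition is_signature :: "('c, 'p) signature \<Rightarrow> bool" where
  "is_signature \<sigma> \<longleftrightarrow>
     countable (sig_cst \<sigma>) \<and> infinite (sig_cst \<sigma>) \<and> countable (sig_prd \<sigma>) \<and>
     (\<forall>P \<in> sig_prd \<sigma>. sig_ar \<sigma> P > 0)"

datatype 'c trm = Cst 'c | Var nat

datatype ('c, 'p) fm =
    Prd 'p "'c trm list"
  | Eq "'c trm" "'c trm" (infix "\<doteq>" 140)
  | And "('c, 'p) fm" "('c, 'p) fm" (infixr "\<^bold>\<and>" 135)
  | Or "('c, 'p) fm" "('c, 'p) fm" (infixr "\<^bold>\<or>" 130)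
  | Imp "('c, 'p) fm" "('c, 'p) fm" (infixr "\<^bold>\<longrightarrow>" 125)
  | Box "('c, 'p) fm"
  | Dia "('c, 'p) fm"
  | All nat "('c, 'p) fm"
  | Exi nat "('c, 'p) fm"
  | Bot

abbreviation Neg :: "('c, 'p) fm \<Rightarrow> ('c, 'p) fm" where
  "Neg \<phi> \<equiv> \<phi> \<^bold>\<longrightarrow> Bot"

abbreviation Top :: "('c, 'p) fm" where
  "Top \<equiv> Neg Bot"

abbreviation Iff :: "('c, 'p) fm \<Rightarrow> ('c, 'p) fm \<Rightarrow> ('c, 'p) fm" (infix "\<^bold>\<longleftrightarrow>" 120) where
  "\<phi> \<^bold>\<longleftrightarrow> \<psi> \<equiv> (\<phi> \<^bold>\<longrightarrow> \<psi>) \<^bold>\<and> (\<psi> \<^bold>\<longrightarrow> \<phi>)"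

primrec cst_trm :: "'c trm \<Rightarrow> 'c set" where
  "cst_trm (Cst c) = {c}"
| "cst_trm (Var y) = {}"

primrec fv_trm :: "'c trm \<Rightarrow> nat set" where
  "fv_trm (Cst c) = {}"
| "fv_trm (Var y) = {y}"

primrec cst_fm :: "('c, 'p) fm \<Rightarrow> 'c set" where
  "cst_fm (Prd P ts) = (\<Union>t \<in> set ts. cst_trm t)"
| "cst_fm (s \<doteq> t) = cst_trm s \<union> cst_trm t"
| "cst_fm (\<phi> \<^bold>\<and> \<psi>) = cst_fm \<phi> \<union> cst_fm \<psi>"
| "cst_fm (\<phi> \<^bold>\<or> \<psi>) = cst_fm \<phi> \<union> cst_fm \<psi>"
| "cst_fm (\<phi> \<^bold>\<longrightarrow> \<psi>) = cst_fm \<phi> \<union> cst_fm \<psi>"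
| "cst_fm (Box \<phi>) = cst_fm \<phi>"
| "cst_fm (Dia \<phi>) = cst_fm \<phi>"
| "cst_fm (All y \<phi>) = cst_fm \<phi>"
| "cst_fm (Exi y \<phi>) = cst_fm \<phi>"
| "cst_fm Bot = {}"

primrec fv :: "('c, 'p) fm \<Rightarrow> nat set" where
  "fv (Prd P ts) = (\<Union>t \<in> set ts. fv_trm t)"
| "fv (s \<doteq> t) = fv_trm s \<union> fv_trm t"
| "fv (\<phi> \<^bold>\<and> \<psi>) = fv \<phi> \<union> fv \<psi>"
| "fv (\<phi> \<^bold>\<or> \<psi>) = fv \<phi> \<union> fv \<psi>"
| "fv (\<phi> \<^bold>\<longrightarrow> \<psi>) = fv \<phi> \<union> fv \<psi>"
| "fv (Box \<phi>) = fv \<phi>"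
| "fv (Dia \<phi>) = fv \<phi>"
| "fv (All y \<phi>) = fv \<phi> - {y}"
| "fv (Exi y \<phi>) = fv \<phi> - {y}"
| "fv Bot = {}"

primrec wf_fm :: "('c, 'p) signature \<Rightarrow> ('c, 'p) fm \<Rightarrow> bool" where
  "wf_fm \<sigma> (Prd P ts) \<longleftrightarrow>
     P \<in> sig_prd \<sigma> \<and> length ts = sig_ar \<sigma> P \<and> (\<forall>t \<in> set ts. cst_trm t \<subseteq> sig_cst \<sigma>)"
| "wf_fm \<sigma> (s \<doteq> t) \<longleftrightarrow> cst_trm s \<subseteq> sig_cst \<sigma> \<and> cst_trm t \<subseteq> sig_cst \<sigma>"
| "wf_fm \<sigma> (\<phi> \<^bold>\<and> \<psi>) \<longleftrightarrow> wf_fm \<sigma> \<phi> \<and> wf_fm \<sigma> \<psi>"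
| "wf_fm \<sigma> (\<phi> \<^bold>\<or> \<psi>) \<longleftrightarrow> wf_fm \<sigma> \<phi> \<and> wf_fm \<sigma> \<psi>"
| "wf_fm \<sigma> (\<phi> \<^bold>\<longrightarrow> \<psi>) \<longleftrightarrow> wf_fm \<sigma> \<phi> \<and> wf_fm \<sigma> \<psi>"
| "wf_fm \<sigma> (Box \<phi>) \<longleftrightarrow> wf_fm \<sigma> \<phi>"
| "wf_fm \<sigma> (Dia \<phi>) \<longleftrightarrow> wf_fm \<sigma> \<phi>"
| "wf_fm \<sigma> (All y \<phi>) \<longleftrightarrow> wf_fm \<sigma> \<phi>"
| "wf_fm \<sigma> (Exi y \<phi>) \<longleftrightarrow> wf_fm \<sigma> \<phi>"
| "wf_fm \<sigma> Bot \<longleftrightarrow> True"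

definition sentences :: "('c, 'p) signature \<Rightarrow> ('c, 'p) fm set" where
  "sentences \<sigma> = {\<phi>. wf_fm \<sigma> \<phi> \<and> fv \<phi> = {}}"

definition one_place :: "('c, 'p) signature \<Rightarrow> nat \<Rightarrow> ('c, 'p) fm \<Rightarrow> bool" where
  "one_place \<sigma> x \<phi> \<longleftrightarrow> wf_fm \<sigma> \<phi> \<and> fv \<phi> = {x}"

primrec modal_free :: "('c, 'p) fm \<Rightarrow> bool" where
  "modal_free (Prd P ts) \<longleftrightarrow> True"
| "modal_free (s \<doteq> t) \<longleftrightarrow> True"
| "modal_free (\<phi> \<^bold>\<and> \<psi>) \<longleftrightarrow> modal_free \<phi> \<and> modal_free \<psi>"
| "modal_free (\<phi> \<^bold>\<or> \<psi>) \<longleftrightarrow> modal_free \<phi> \<and> modal_free \<psi>"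
| "modal_free (\<phi> \<^bold>\<longrightarrow> \<psi>) \<longleftrightarrow> modal_free \<phi> \<and> modal_free \<psi>"
| "modal_free (Box \<phi>) \<longleftrightarrow> False"
| "modal_free (Dia \<phi>) \<longleftrightarrow> False"
| "modal_free (All y \<phi>) \<longleftrightarrow> modal_free \<phi>"
| "modal_free (Exi y \<phi>) \<longleftrightarrow> modal_free \<phi>"
| "modal_free Bot \<longleftrightarrow> True"

primrec inst_trm :: "nat \<Rightarrow> 'c \<Rightarrow> 'c trm \<Rightarrow> 'c trm" where
  "inst_trm x c (Cst d) = Cst d"
| "inst_trm x c (Var y) = (if y = x then Cst c else Var y)"

text \<open>\<open>inst x c \<phi>\<close> puts the constant \<open>c\<close> for the free occurrences of \<open>x\<close>: if \<open>x\<close> is the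
  free variable of a one-place \<open>\<phi>\<close>, this is \<open>\<phi>(c)\<close>, while \<open>\<phi>(x)\<close> is \<open>\<phi>\<close> itself.\<close>

primrec inst :: "nat \<Rightarrow> 'c \<Rightarrow> ('c, 'p) fm \<Rightarrow> ('c, 'p) fm" where
  "inst x c (Prd P ts) = Prd P (map (inst_trm x c) ts)"
| "inst x c (s \<doteq> t) = (inst_trm x c s \<doteq> inst_trm x c t)"
| "inst x c (\<phi> \<^bold>\<and> \<psi>) = (inst x c \<phi> \<^bold>\<and> inst x c \<psi>)"
| "inst x c (\<phi> \<^bold>\<or> \<psi>) = (inst x c \<phi> \<^bold>\<or> inst x c \<psi>)"
| "inst x c (\<phi> \<^bold>\<longrightarrow> \<psi>) = (inst x c \<phi> \<^bold>\<longrightarrow> inst x c \<psi>)"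
| "inst x c (Box \<phi>) = Box (inst x c \<phi>)"
| "inst x c (Dia \<phi>) = Dia (inst x c \<phi>)"
| "inst x c (All y \<phi>) = All y (if y = x then \<phi> else inst x c \<phi>)"
| "inst x c (Exi y \<phi>) = Exi y (if y = x then \<phi> else inst x c \<phi>)"
| "inst x c Bot = Bot"

primrec repl_trm :: "'c \<Rightarrow> nat \<Rightarrow> 'c trm \<Rightarrow> 'c trm" where
  "repl_trm c x (Cst d) = (if d = c then Var x else Cst d)"
| "repl_trm c x (Var y) = Var y"

primrec repl :: "'c \<Rightarrow> nat \<Rightarrow> ('c, 'p) fm \<Rightarrow> ('c, 'p) fm" where
  "repl c x (Prd P ts) = Prd P (map (repl_trm c x) ts)"
| "repl c x (s \<doteq> t) = (repl_trm c x s \<doteq> repl_trm c x t)"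
| "repl c x (\<phi> \<^bold>\<and> \<psi>) = (repl c x \<phi> \<^bold>\<and> repl c x \<psi>)"
| "repl c x (\<phi> \<^bold>\<or> \<psi>) = (repl c x \<phi> \<^bold>\<or> repl c x \<psi>)"
| "repl c x (\<phi> \<^bold>\<longrightarrow> \<psi>) = (repl c x \<phi> \<^bold>\<longrightarrow> repl c x \<psi>)"
| "repl c x (Box \<phi>) = Box (repl c x \<phi>)"
| "repl c x (Dia \<phi>) = Dia (repl c x \<phi>)"
| "repl c x (All y \<phi>) = All y (repl c x \<phi>)"
| "repl c x (Exi y \<phi>) = Exi y (repl c x \<phi>)"
| "repl c x Bot = Bot"

text \<open>\<open>x\<close> is substitutable for \<open>c\<close> if no occurrence of \<open>c\<close> lies in the scope of a quantifier
  binding \<open>x\<close>.\<close>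

primrec substitutable :: "nat \<Rightarrow> 'c \<Rightarrow> ('c, 'p) fm \<Rightarrow> bool" where
  "substitutable x c (Prd P ts) \<longleftrightarrow> True"
| "substitutable x c (s \<doteq> t) \<longleftrightarrow> True"
| "substitutable x c (\<phi> \<^bold>\<and> \<psi>) \<longleftrightarrow> substitutable x c \<phi> \<and> substitutable x c \<psi>"
| "substitutable x c (\<phi> \<^bold>\<or> \<psi>) \<longleftrightarrow> substitutable x c \<phi> \<and> substitutable x c \<psi>"
| "substitutable x c (\<phi> \<^bold>\<longrightarrow> \<psi>) \<longleftrightarrow> substitutable x c \<phi> \<and> substitutable x c \<psi>"
| "substitutable x c (Box \<phi>) \<longleftrightarrow> substitutable x c \<phi>"
| "substitutable x c (Dia \<phi>) \<longleftrightarrow> substitutable x c \<phi>"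
| "substitutable x c (All y \<phi>) \<longleftrightarrow> (y = x \<longrightarrow> c \<notin> cst_fm \<phi>) \<and> substitutable x c \<phi>"
| "substitutable x c (Exi y \<phi>) \<longleftrightarrow> (y = x \<longrightarrow> c \<notin> cst_fm \<phi>) \<and> substitutable x c \<phi>"
| "substitutable x c Bot \<longleftrightarrow> True"


section \<open>Intuitionistic propositional logic\<close>

datatype pfm =
    PAtom nat
  | PAnd pfm pfm
  | POr pfm pfm
  | PImp pfm pfm
  | PBot

inductive ipc :: "pfm \<Rightarrow> bool" where
  ipc_K: "ipc (PImp p (PImp q p))"
| ipc_S: "ipc (PImp (PImp p (PImp q r)) (PImp (PImp p q) (PImp p r)))"
| ipc_andE1: "ipc (PImp (PAnd p q) p)"
| ipc_andE2: "ipc (PImp (PAnd p q) q)"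
| ipc_andI: "ipc (PImp p (PImp q (PAnd p q)))"
| ipc_orI1: "ipc (PImp p (POr p q))"
| ipc_orI2: "ipc (PImp q (POr p q))"
| ipc_orE: "ipc (PImp (PImp p r) (PImp (PImp q r) (PImp (POr p q) r)))"
| ipc_efq: "ipc (PImp PBot p)"
| ipc_mp: "ipc p \<Longrightarrow> ipc (PImp p q) \<Longrightarrow> ipc q"

primrec psubst :: "(nat \<Rightarrow> ('c, 'p) fm) \<Rightarrow> pfm \<Rightarrow> ('c, 'p) fm" where
  "psubst s (PAtom i) = s i"
| "psubst s (PAnd p q) = (psubst s p \<^bold>\<and> psubst s q)"
| "psubst s (POr p q) = (psubst s p \<^bold>\<or> psubst s q)"
| "psubst s (PImp p q) = (psubst s p \<^bold>\<longrightarrow> psubst s q)"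
| "psubst s PBot = Bot"


section \<open>The Hilbert system FOFS\<close>

text \<open>In the generalization rule, \<open>\<phi>\<close> plays the role of \<open>\<phi>(c)\<close>, and \<open>\<phi>(x)\<close> results from it by
  replacing every occurrence of \<open>c\<close> by \<open>x\<close>. Keeping some occurrences of \<open>c\<close> would be unsound:
  \<open>c \<doteq> c\<close> would yield \<open>\<forall>x. x \<doteq> c\<close>. The premise \<open>c \<in> cst_fm \<phi>\<close> says that \<open>\<phi>(x)\<close> is
  one-place.\<close>

inductive fofs :: "('c, 'p) signature \<Rightarrow> ('c, 'p) fm \<Rightarrow> bool" for \<sigma> :: "('c, 'p) signature" where
  ax_ipc: "ipc p \<Longrightarrow> (\<And>i. s i \<in> sentences \<sigma>) \<Longrightarrow> fofs \<sigma> (psubst s p)"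
| ax_box_and: "\<phi> \<in> sentences \<sigma> \<Longrightarrow> \<psi> \<in> sentences \<sigma> \<Longrightarrow>
    fofs \<sigma> (Box (\<phi> \<^bold>\<and> \<psi>) \<^bold>\<longleftrightarrow> (Box \<phi> \<^bold>\<and> Box \<psi>))"
| ax_box_top: "fofs \<sigma> (Box Top)"
| ax_dia_or: "\<phi> \<in> sentences \<sigma> \<Longrightarrow> \<psi> \<in> sentences \<sigma> \<Longrightarrow>
    fofs \<sigma> (Dia (\<phi> \<^bold>\<or> \<psi>) \<^bold>\<longleftrightarrow> (Dia \<phi> \<^bold>\<or> Dia \<psi>))"
| ax_dia_bot: "fofs \<sigma> (Neg (Dia Bot))"
| ax_FS1: "\<phi> \<in> sentences \<sigma> \<Longrightarrow> \<psi> \<in> sentences \<sigma> \<Longrightarrow>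
    fofs \<sigma> ((Dia \<phi> \<^bold>\<longrightarrow> Box \<psi>) \<^bold>\<longrightarrow> Box (\<phi> \<^bold>\<longrightarrow> \<psi>))"
| ax_FS2: "\<phi> \<in> sentences \<sigma> \<Longrightarrow> \<psi> \<in> sentences \<sigma> \<Longrightarrow>
    fofs \<sigma> (Dia (\<phi> \<^bold>\<longrightarrow> \<psi>) \<^bold>\<longrightarrow> (Box \<phi> \<^bold>\<longrightarrow> Dia \<psi>))"
| ax_allE: "one_place \<sigma> x \<phi> \<Longrightarrow> c \<in> sig_cst \<sigma> \<Longrightarrow> fofs \<sigma> (All x \<phi> \<^bold>\<longrightarrow> inst x c \<phi>)"
| ax_exI: "one_place \<sigma> x \<phi> \<Longrightarrow> c \<in> sig_cst \<sigma> \<Longrightarrow> fofs \<sigma> (inst x c \<phi> \<^bold>\<longrightarrow> Exi x \<phi>)"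
| ax_all_ex: "one_place \<sigma> x \<phi> \<Longrightarrow> \<psi> \<in> sentences \<sigma> \<Longrightarrow>
    fofs \<sigma> (All x (\<phi> \<^bold>\<longrightarrow> \<psi>) \<^bold>\<longrightarrow> (Exi x \<phi> \<^bold>\<longrightarrow> \<psi>))"
| ax_all_imp: "\<phi> \<in> sentences \<sigma> \<Longrightarrow> one_place \<sigma> x \<psi> \<Longrightarrow>
    fofs \<sigma> (All x (\<phi> \<^bold>\<longrightarrow> \<psi>) \<^bold>\<longrightarrow> (\<phi> \<^bold>\<longrightarrow> All x \<psi>))"
| ax_refl: "c \<in> sig_cst \<sigma> \<Longrightarrow> fofs \<sigma> (Cst c \<doteq> Cst c)"
| ax_leibniz: "one_place \<sigma> x \<phi> \<Longrightarrow> modal_free \<phi> \<Longrightarrow> c1 \<in> sig_cst \<sigma> \<Longrightarrow> c2 \<in> sig_cst \<sigma> \<Longrightarrow>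
    fofs \<sigma> ((Cst c1 \<doteq> Cst c2) \<^bold>\<longrightarrow> (inst x c1 \<phi> \<^bold>\<longrightarrow> inst x c2 \<phi>))"
| rule_mp: "fofs \<sigma> \<phi> \<Longrightarrow> fofs \<sigma> (\<phi> \<^bold>\<longrightarrow> \<psi>) \<Longrightarrow> fofs \<sigma> \<psi>"
| rule_gen: "fofs \<sigma> \<phi> \<Longrightarrow> c \<in> cst_fm \<phi> \<Longrightarrow> substitutable x c \<phi> \<Longrightarrow> fofs \<sigma> (All x (repl c x \<phi>))"
| rule_box: "fofs \<sigma> (\<phi> \<^bold>\<longrightarrow> \<psi>) \<Longrightarrow> fofs \<sigma> (Box \<phi> \<^bold>\<longrightarrow> Box \<psi>)"
| rule_dia: "fofs \<sigma> (\<phi> \<^bold>\<longrightarrow> \<psi>) \<Longrightarrow> fofs \<sigma> (Dia \<phi> \<^bold>\<longrightarrow> Dia \<psi>)"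

fun big_and :: "('c, 'p) fm list \<Rightarrow> ('c, 'p) fm" where
  "big_and [] = Top"
| "big_and [\<gamma>] = \<gamma>"
| "big_and (\<gamma> # \<gamma>' # \<gamma>s) = (\<gamma> \<^bold>\<and> big_and (\<gamma>' # \<gamma>s))"

definition fofs_derives :: "('c, 'p) signature \<Rightarrow> ('c, 'p) fm set \<Rightarrow> ('c, 'p) fm \<Rightarrow> bool" where
  "fofs_derives \<sigma> \<Gamma> \<phi> \<longleftrightarrow> (\<exists>\<gamma>s. set \<gamma>s \<subseteq> \<Gamma> \<and> fofs \<sigma> (big_and \<gamma>s \<^bold>\<longrightarrow> \<phi>))"


section \<open>Semantics\<close>

record ('w, 'd, 'c, 'p) model =
  worlds :: "'w set"
  ord :: "('w \<times> 'w) set"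
  acc :: "('w \<times> 'w) set"
  Dom :: "'w \<Rightarrow> 'd set"
  eqv :: "'w \<Rightarrow> ('d \<times> 'd) set"
  icst :: "'c \<Rightarrow> 'd"
  iprd :: "'w \<Rightarrow> 'p \<Rightarrow> 'd list set"

definition fs_frame :: "'w set \<Rightarrow> ('w \<times> 'w) set \<Rightarrow> ('w \<times> 'w) set \<Rightarrow> bool" where
  "fs_frame W L R \<longleftrightarrow>
     partial_order_on W L \<and> R \<subseteq> W \<times> W \<and>
     (\<forall>w v v'. (w, v) \<in> R \<and> (v, v') \<in> L \<longrightarrow> (\<exists>w'. (w, w') \<in> L \<and> (w', v') \<in> R)) \<and>
     (\<forall>w w' v. (w, w') \<in> L \<and> (w, v) \<in> R \<longrightarrow> (\<exists>v'. (v, v') \<in> L \<and> (w', v') \<in> R))"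

definition domain_system ::
  "'w set \<Rightarrow> ('w \<times> 'w) set \<Rightarrow> ('w \<times> 'w) set \<Rightarrow> ('w \<Rightarrow> 'd set) \<Rightarrow> ('w \<Rightarrow> ('d \<times> 'd) set) \<Rightarrow> bool" where
  "domain_system W L R D E \<longleftrightarrow>
     (\<forall>w w'. (w, w') \<in> L \<union> R \<longrightarrow> D w \<subseteq> D w') \<and>
     (\<forall>w \<in> W. equiv (D w) (E w)) \<and>
     (\<forall>w w'. (w, w') \<in> L \<longrightarrow> E w \<subseteq> E w')"

definition fofs_model :: "('c, 'p) signature \<Rightarrow> ('w, 'd, 'c, 'p) model \<Rightarrow> bool" where
  "fofs_model \<sigma> M \<longleftrightarrow>
     fs_frame (worlds M) (ord M) (acc M) \<and>
     domain_system (worlds M) (ord M) (acc M) (Dom M) (eqv M) \<and>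
     (\<forall>c \<in> sig_cst \<sigma>. \<forall>w \<in> worlds M. icst M c \<in> Dom M w) \<and>
     (\<forall>P \<in> sig_prd \<sigma>.
        (\<forall>w \<in> worlds M. iprd M w P \<subseteq> {as. length as = sig_ar \<sigma> P \<and> set as \<subseteq> Dom M w}) \<and>
        (\<forall>w w'. (w, w') \<in> ord M \<longrightarrow> iprd M w P \<subseteq> iprd M w' P) \<and>
        (\<forall>w \<in> worlds M. \<forall>as bs.
           as \<in> iprd M w P \<and> list_all2 (\<lambda>a b. (a, b) \<in> eqv M w) as bs \<longrightarrow> bs \<in> iprd M w P))"

primrec val :: "('w, 'd, 'c, 'p) model \<Rightarrow> (nat \<Rightarrow> 'd) \<Rightarrow> 'c trm \<Rightarrow> 'd" where
  "val M g (Cst c) = icst M c"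
| "val M g (Var y) = g y"

primrec sat :: "('w, 'd, 'c, 'p) model \<Rightarrow> 'w \<Rightarrow> (nat \<Rightarrow> 'd) \<Rightarrow> ('c, 'p) fm \<Rightarrow> bool" where
  "sat M w g (Prd P ts) \<longleftrightarrow> map (val M g) ts \<in> iprd M w P"
| "sat M w g (s \<doteq> t) \<longleftrightarrow> (val M g s, val M g t) \<in> eqv M w"
| "sat M w g (\<phi> \<^bold>\<and> \<psi>) \<longleftrightarrow> sat M w g \<phi> \<and> sat M w g \<psi>"
| "sat M w g (\<phi> \<^bold>\<or> \<psi>) \<longleftrightarrow> sat M w g \<phi> \<or> sat M w g \<psi>"
| "sat M w g (\<phi> \<^bold>\<longrightarrow> \<psi>) \<longleftrightarrow> (\<forall>w'. (w, w') \<in> ord M \<longrightarrow> \<not> sat M w' g \<phi> \<or> sat M w' g \<psi>)"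
| "sat M w g (Box \<phi>) \<longleftrightarrow> (\<forall>w' v'. (w, w') \<in> ord M \<and> (w', v') \<in> acc M \<longrightarrow> sat M v' g \<phi>)"
| "sat M w g (Dia \<phi>) \<longleftrightarrow> (\<exists>v. (w, v) \<in> acc M \<and> sat M v g \<phi>)"
| "sat M w g (All x \<phi>) \<longleftrightarrow> (\<forall>w'. (w, w') \<in> ord M \<longrightarrow> (\<forall>a \<in> Dom M w'. sat M w' (g(x := a)) \<phi>))"
| "sat M w g (Exi x \<phi>) \<longleftrightarrow> (\<exists>a \<in> Dom M w. sat M w (g(x := a)) \<phi>)"
| "sat M w g Bot \<longleftrightarrow> False"

text \<open>Truth of a sentence. Its value does not depend on the assignment, and assignments into
  \<open>Dom M w\<close> exist because a signature has constants.\<close>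

definition holds :: "('w, 'd, 'c, 'p) model \<Rightarrow> 'w \<Rightarrow> ('c, 'p) fm \<Rightarrow> bool" where
  "holds M w \<phi> \<longleftrightarrow> (\<forall>g. range g \<subseteq> Dom M w \<longrightarrow> sat M w g \<phi>)"

text \<open>The type arguments name the types from which worlds and domain elements are drawn.\<close>

definition fofs_entails ::
  "'w itself \<Rightarrow> 'd itself \<Rightarrow> ('c, 'p) signature \<Rightarrow> ('c, 'p) fm set \<Rightarrow> ('c, 'p) fm \<Rightarrow> bool" where
  "fofs_entails _ _ \<sigma> \<Gamma> \<phi> \<longleftrightarrow>
     (\<forall>M :: ('w, 'd, 'c, 'p) model. fofs_model \<sigma> M \<longrightarrow>
        (\<forall>w \<in> worlds M. (\<forall>\<gamma> \<in> \<Gamma>. holds M w \<gamma>) \<longrightarrow> holds M w \<phi>))"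

end

theory Submission
  imports Defs
begin

text \<open>Every theorem of the Hilbert system is true at every world of every model under every
  assignment. The critical rule is generalization: an element \<open>a\<close> of the domain of a world \<open>w\<close>
  need not lie in the domains of all worlds, so \<open>c\<close> cannot simply be reinterpreted as \<open>a\<close>. It can
  after passing to the submodel generated by \<open>w\<close> under the order and the accessibility relation:
  domains grow along both, the two confluence conditions survive, and truth is preserved.\<close>

section \<open>Assignments, constants and substitution\<close>

lemma val_cong_fv: "\<forall>y \<in> fv_trm t. g y = h y \<Longrightarrow> val M g t = val M h t"
  by (cases t) auto

lemma sat_cong_fv: "\<forall>y \<in> fv \<phi>. g y = h y \<Longrightarrow> sat M w g \<phi> \<longleftrightarrow> sat M w h \<phi>"
proof (induction \<phi> arbitrary: w g h)
  case (Prd P ts)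
  then have "map (val M g) ts = map (val M h) ts"
    by (auto intro!: val_cong_fv)
  then show ?case by (simp only: sat.simps)
next
  case (Eq s t)
  then have "val M g s = val M h s" "val M g t = val M h t"
    by (auto intro!: val_cong_fv)
  then show ?case by simp
next
  case (And \<phi> \<psi>)
  then have "sat M w g \<phi> = sat M w h \<phi>" "sat M w g \<psi> = sat M w h \<psi>" by auto
  then show ?case by simp
next
  case (Or \<phi> \<psi>)
  then have "sat M w g \<phi> = sat M w h \<phi>" "sat M w g \<psi> = sat M w h \<psi>" by auto
  then show ?case by simp
next
  case (Imp \<phi> \<psi>)
  then have "sat M v g \<phi> = sat M v h \<phi>" "sat M v g \<psi> = sat M v h \<psi>" for v by auto
  then show ?case by simp
next
  case (Box \<phi>)
  then have "sat M v g \<phi> = sat M v h \<phi>" for v by auto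
  then show ?case by simp
next
  case (Dia \<phi>)
  then have "sat M v g \<phi> = sat M v h \<phi>" for v by auto
  then show ?case by simp
next
  case (All y \<phi>)
  have "sat M v (g(y := a)) \<phi> = sat M v (h(y := a)) \<phi>" for v a
    using All.prems by (intro All.IH) auto
  then show ?case by simp
next
  case (Exi y \<phi>)
  have "sat M v (g(y := a)) \<phi> = sat M v (h(y := a)) \<phi>" for v a
    using Exi.prems by (intro Exi.IH) auto
  then show ?case by simp
qed simp

lemma sat_fun_upd_sentence:
  assumes "\<phi> \<in> sentences \<sigma>"
  shows "sat M w (g(x := a)) \<phi> \<longleftrightarrow> sat M w g \<phi>"
  using assms by (intro sat_cong_fv) (simp add: sentences_def)

lemma val_inst_trm: "val M g (inst_trm x c t) = val M (g(x := icst M c)) t"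
  by (cases t) auto

text \<open>Only a constant is inserted, so no variable can be captured, and constants are rigid:
  the update of \<open>g\<close> at \<open>x\<close> is the same at every world that the clauses for
  the connectives and modalities visit.\<close>

lemma sat_inst: "sat M w g (inst x c \<phi>) \<longleftrightarrow> sat M w (g(x := icst M c)) \<phi>"
  by (induction \<phi> arbitrary: w g) (auto simp: val_inst_trm comp_def fun_upd_twist)

section \<open>Changing the denotation of one constant\<close>

definition reinterpret ::
  "'c \<Rightarrow> 'd \<Rightarrow> ('w, 'd, 'c, 'p) model \<Rightarrow> ('w, 'd, 'c, 'p) model" where
  "reinterpret c a M = M\<lparr>icst := (icst M)(c := a)\<rparr>"

lemma reinterpret_simps [simp]:
  "worlds (reinterpret c a M) = worlds M"
  "ord (reinterpret c a M) = ord M"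
  "acc (reinterpret c a M) = acc M"
  "Dom (reinterpret c a M) = Dom M"
  "eqv (reinterpret c a M) = eqv M"
  "icst (reinterpret c a M) = (icst M)(c := a)"
  "iprd (reinterpret c a M) = iprd M"
  by (simp_all add: reinterpret_def)

lemma val_reinterpret_fresh: "c \<notin> cst_trm t \<Longrightarrow> val (reinterpret c a M) g t = val M g t"
  by (cases t) auto

lemma sat_reinterpret_fresh:
  "c \<notin> cst_fm \<phi> \<Longrightarrow> sat (reinterpret c a M) w g \<phi> \<longleftrightarrow> sat M w g \<phi>"
proof (induction \<phi> arbitrary: w g)
  case (Prd P ts)
  then have "map (val (reinterpret c a M) g) ts = map (val M g) ts"
    by (auto intro!: val_reinterpret_fresh)
  then show ?case by (simp only: sat.simps reinterpret_simps)
qed (auto simp: val_reinterpret_fresh)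

lemma repl_trm_fresh: "c \<notin> cst_trm t \<Longrightarrow> repl_trm c x t = t"
  by (cases t) auto

lemma repl_fresh: "c \<notin> cst_fm \<phi> \<Longrightarrow> repl c x \<phi> = \<phi>"
  by (induction \<phi>) (auto simp: repl_trm_fresh intro!: map_idI)

lemma val_repl_trm: "g x = a \<Longrightarrow> val M g (repl_trm c x t) = val (reinterpret c a M) g t"
  by (cases t) auto

text \<open>This turns a variable ranging over a domain into a new denotation for \<open>c\<close>.
  Below a quantifier on \<open>x\<close>, substitutability leaves no occurrence of \<open>c\<close>,
  so both the replacement and the reinterpretation are vacuous; below any other quantifier the
  condition \<open>g x = a\<close> survives the update.\<close>

lemma sat_repl:
  "substitutable x c \<phi> \<Longrightarrow> g x = a \<Longrightarrow>
    sat M w g (repl c x \<phi>) \<longleftrightarrow> sat (reinterpret c a M) w g \<phi>"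
proof (induction \<phi> arbitrary: w g)
  case (All y \<phi>)
  then show ?case
    by (cases "y = x") (auto simp: repl_fresh sat_reinterpret_fresh)
next
  case (Exi y \<phi>)
  then show ?case
    by (cases "y = x") (auto simp: repl_fresh sat_reinterpret_fresh)
qed (auto simp: val_repl_trm comp_def)

section \<open>Properties of models\<close>

lemma fofs_model_ord_refl: "fofs_model \<sigma> M \<Longrightarrow> w \<in> worlds M \<Longrightarrow> (w, w) \<in> ord M"
  by (auto simp: fofs_model_def fs_frame_def partial_order_on_def preorder_on_def refl_on_def)

lemma fofs_model_ord_trans:
  "fofs_model \<sigma> M \<Longrightarrow> (u, v) \<in> ord M \<Longrightarrow> (v, w) \<in> ord M \<Longrightarrow> (u, w) \<in> ord M"
  by (auto simp: fofs_model_def fs_frame_def partial_order_on_def preorder_on_def dest: transD)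

lemma fofs_model_ord_worlds:
  "fofs_model \<sigma> M \<Longrightarrow> (u, v) \<in> ord M \<Longrightarrow> u \<in> worlds M \<and> v \<in> worlds M"
  by (auto simp: fofs_model_def fs_frame_def partial_order_on_def preorder_on_def refl_on_def)

lemma fofs_model_acc_worlds:
  "fofs_model \<sigma> M \<Longrightarrow> (u, v) \<in> acc M \<Longrightarrow> u \<in> worlds M \<and> v \<in> worlds M"
  by (auto simp: fofs_model_def fs_frame_def)

lemma fofs_model_FC1:
  assumes "fofs_model \<sigma> M" "(w, v) \<in> acc M" "(v, v') \<in> ord M"
  obtains w' where "(w, w') \<in> ord M" "(w', v') \<in> acc M"
  using assms unfolding fofs_model_def fs_frame_def by blast

lemma fofs_model_FC2:
  assumes "fofs_model \<sigma> M" "(w, w') \<in> ord M" "(w, v) \<in> acc M"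
  obtains v' where "(v, v') \<in> ord M" "(w', v') \<in> acc M"
  using assms unfolding fofs_model_def fs_frame_def by blast

lemma fofs_model_Dom_mono:
  "fofs_model \<sigma> M \<Longrightarrow> (w, w') \<in> ord M \<union> acc M \<Longrightarrow> Dom M w \<subseteq> Dom M w'"
  unfolding fofs_model_def domain_system_def by blast

lemma fofs_model_equiv: "fofs_model \<sigma> M \<Longrightarrow> w \<in> worlds M \<Longrightarrow> equiv (Dom M w) (eqv M w)"
  by (simp add: fofs_model_def domain_system_def)

lemma fofs_model_eqv_mono: "fofs_model \<sigma> M \<Longrightarrow> (w, w') \<in> ord M \<Longrightarrow> eqv M w \<subseteq> eqv M w'"
  by (simp add: fofs_model_def domain_system_def)

lemma fofs_model_icst:
  "fofs_model \<sigma> M \<Longrightarrow> c \<in> sig_cst \<sigma> \<Longrightarrow> w \<in> worlds M \<Longrightarrow> icst M c \<in> Dom M w"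
  by (simp add: fofs_model_def)

lemma fofs_model_iprd_arity:
  "fofs_model \<sigma> M \<Longrightarrow> P \<in> sig_prd \<sigma> \<Longrightarrow> w \<in> worlds M \<Longrightarrow>
    iprd M w P \<subseteq> {as. length as = sig_ar \<sigma> P \<and> set as \<subseteq> Dom M w}"
  by (simp add: fofs_model_def)

lemma fofs_model_iprd_mono:
  "fofs_model \<sigma> M \<Longrightarrow> P \<in> sig_prd \<sigma> \<Longrightarrow> (w, w') \<in> ord M \<Longrightarrow> iprd M w P \<subseteq> iprd M w' P"
  by (simp add: fofs_model_def)

lemma fofs_model_iprd_eqv:
  "fofs_model \<sigma> M \<Longrightarrow> P \<in> sig_prd \<sigma> \<Longrightarrow> w \<in> worlds M \<Longrightarrow> as \<in> iprd M w P \<Longrightarrow>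
    list_all2 (\<lambda>a b. (a, b) \<in> eqv M w) as bs \<Longrightarrow> bs \<in> iprd M w P"
  unfolding fofs_model_def by blast

lemma fofs_model_eqv_refl:
  "fofs_model \<sigma> M \<Longrightarrow> w \<in> worlds M \<Longrightarrow> a \<in> Dom M w \<Longrightarrow> (a, a) \<in> eqv M w"
  using fofs_model_equiv by (metis equiv_class_self equiv_def refl_onD)

lemma fofs_model_eqv_sym:
  "fofs_model \<sigma> M \<Longrightarrow> w \<in> worlds M \<Longrightarrow> (a, b) \<in> eqv M w \<Longrightarrow> (b, a) \<in> eqv M w"
  using fofs_model_equiv by (metis equiv_def symD)

lemma fofs_model_eqv_trans:
  "fofs_model \<sigma> M \<Longrightarrow> w \<in> worlds M \<Longrightarrow> (a, b) \<in> eqv M w \<Longrightarrow> (b, d) \<in> eqv M w \<Longrightarrow>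
    (a, d) \<in> eqv M w"
  using fofs_model_equiv by (metis equiv_def transD)

text \<open>The clauses for implication, \<open>Box\<close> and \<open>All\<close> already quantify
  over later worlds, so transitivity of the order suffices there. \<open>Dia\<close> looks only at
  the current world, and (FC2) is what moves its witness. Well-formedness enters at atoms, since
  \<open>iprd\<close> is monotone for the predicate symbols of the signature.\<close>

lemma sat_persistent:
  assumes M: "fofs_model \<sigma> M"
  shows "wf_fm \<sigma> \<phi> \<Longrightarrow> (w, w') \<in> ord M \<Longrightarrow> sat M w g \<phi> \<Longrightarrow> sat M w' g \<phi>"
proof (induction \<phi> arbitrary: w w' g)
  case (Prd P ts)
  then show ?case using fofs_model_iprd_mono[OF M] by auto
next
  case (Eq s t)
  then show ?case using fofs_model_eqv_mono[OF M] by auto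
next
  case (Imp \<phi> \<psi>)
  then show ?case using fofs_model_ord_trans[OF M] by (meson sat.simps(5))
next
  case (Box \<phi>)
  then show ?case using fofs_model_ord_trans[OF M] by (meson sat.simps(6))
next
  case (Dia \<phi>)
  then obtain v where "(w, v) \<in> acc M" "sat M v g \<phi>" by auto
  moreover from this Dia.prems obtain v' where "(v, v') \<in> ord M" "(w', v') \<in> acc M"
    using fofs_model_FC2[OF M] by metis
  ultimately show ?case using Dia by auto
next
  case (All x \<phi>)
  then show ?case using fofs_model_ord_trans[OF M] by (meson sat.simps(8))
next
  case (Exi x \<phi>)
  then obtain a where "a \<in> Dom M w" "sat M w (g(x := a)) \<phi>" by auto
  moreover have "Dom M w \<subseteq> Dom M w'" using fofs_model_Dom_mono[OF M] Exi.prems by blast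
  moreover have "sat M w' (g(x := a)) \<phi>"
    using Exi.IH[OF _ Exi.prems(2)] Exi.prems(1) calculation(2) by simp
  ultimately show ?case by auto
qed auto

section \<open>Equivalent assignments and modal-free formulas\<close>

lemma val_eqv:
  assumes "fofs_model \<sigma> M" "w \<in> worlds M" "cst_trm t \<subseteq> sig_cst \<sigma>"
    and "\<forall>y \<in> fv_trm t. (g y, h y) \<in> eqv M w"
  shows "(val M g t, val M h t) \<in> eqv M w"
  using assms by (cases t) (auto simp: fofs_model_icst fofs_model_eqv_refl)

text \<open>Modal-freeness is needed because equivalences persist along the order but not along the
  accessibility relation.\<close>

lemma sat_eqv_modal_free:
  assumes M: "fofs_model \<sigma> M"
  shows "wf_fm \<sigma> \<phi> \<Longrightarrow> modal_free \<phi> \<Longrightarrow> w \<in> worlds M \<Longrightarrow>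
    \<forall>y \<in> fv \<phi>. (g y, h y) \<in> eqv M w \<Longrightarrow> sat M w g \<phi> \<longleftrightarrow> sat M w h \<phi>"
proof (induction \<phi> arbitrary: w g h)
  case (Prd P ts)
  have *: "list_all2 (\<lambda>a b. (a, b) \<in> eqv M w) (map (val M g') ts) (map (val M h') ts)"
    if "\<forall>y \<in> (\<Union>t \<in> set ts. fv_trm t). (g' y, h' y) \<in> eqv M w" for g' h'
    using that Prd.prems by (auto simp: list_all2_map1 list_all2_map2 list_all2_same
        intro!: val_eqv[OF M])
  \<comment> \<open>Closure of \<open>iprd\<close> under equivalence transfers truth in one
    direction only; with symmetry, \<open>*\<close> also applies with \<open>g\<close> and
    \<open>h\<close> exchanged.\<close>
  have "\<forall>y \<in> (\<Union>t \<in> set ts. fv_trm t). (h y, g y) \<in> eqv M w"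
    using fofs_model_eqv_sym[OF M Prd.prems(3)] Prd.prems(4) by (metis fv.simps(1))
  with Prd.prems have
    "list_all2 (\<lambda>a b. (a, b) \<in> eqv M w) (map (val M g) ts) (map (val M h) ts)"
    "list_all2 (\<lambda>a b. (a, b) \<in> eqv M w) (map (val M h) ts) (map (val M g) ts)"
    by (auto intro!: * simp del: list.map)
  with Prd.prems show ?case
    using fofs_model_iprd_eqv[OF M] by (metis sat.simps(1) wf_fm.simps(1))
next
  case (Eq s t)
  then have "(val M g s, val M h s) \<in> eqv M w" "(val M g t, val M h t) \<in> eqv M w"
    by (auto intro!: val_eqv[OF M])
  then show ?case
    using Eq.prems(3) fofs_model_eqv_sym[OF M] fofs_model_eqv_trans[OF M]
    by (meson sat.simps(2))
next
  case (And \<phi> \<psi>)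
  then have "sat M w g \<phi> = sat M w h \<phi>" "sat M w g \<psi> = sat M w h \<psi>" by auto
  then show ?case by simp
next
  case (Or \<phi> \<psi>)
  then have "sat M w g \<phi> = sat M w h \<phi>" "sat M w g \<psi> = sat M w h \<psi>" by auto
  then show ?case by simp
next
  case (Imp \<phi> \<psi>)
  have "sat M v g \<phi> = sat M v h \<phi>" "sat M v g \<psi> = sat M v h \<psi>" if "(w, v) \<in> ord M" for v
    using Imp.prems that fofs_model_eqv_mono[OF M that] fofs_model_ord_worlds[OF M that]
    by (intro Imp.IH; auto)+
  then show ?case by auto
next
  case (All x \<phi>)
  \<comment> \<open>At the bound variable the pair needed is \<open>(a, a)\<close>, supplied by
    reflexivity because \<open>a\<close> lies in \<open>Dom M v\<close>; the pairs for the other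
    variables persist from \<open>w\<close> to \<open>v\<close>.\<close>
  have "sat M v (g(x := a)) \<phi> = sat M v (h(x := a)) \<phi>"
    if "(w, v) \<in> ord M" "a \<in> Dom M v" for v a
    using All.prems that fofs_model_eqv_mono[OF M that(1)] fofs_model_ord_worlds[OF M that(1)]
    by (intro All.IH) (auto simp: fofs_model_eqv_refl[OF M])
  then show ?case by auto
next
  case (Exi x \<phi>)
  have "sat M w (g(x := a)) \<phi> = sat M w (h(x := a)) \<phi>" if "a \<in> Dom M w" for a
    using Exi.prems that by (intro Exi.IH) (auto simp: fofs_model_eqv_refl[OF M])
  then show ?case by auto
qed auto

section \<open>Generated submodels\<close>

text \<open>Only the frame is cut down. Domains, equivalences and predicate interpretations are
  indexed by worlds, and the model conditions inspect them at worlds of \<open>U\<close>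
  alone.\<close>

definition restrict_worlds ::
  "'w set \<Rightarrow> ('w, 'd, 'c, 'p) model \<Rightarrow> ('w, 'd, 'c, 'p) model" where
  "restrict_worlds U M = M\<lparr>worlds := U, ord := ord M \<inter> U \<times> U, acc := acc M \<inter> U \<times> U\<rparr>"

lemma restrict_worlds_simps [simp]:
  "worlds (restrict_worlds U M) = U"
  "ord (restrict_worlds U M) = ord M \<inter> U \<times> U"
  "acc (restrict_worlds U M) = acc M \<inter> U \<times> U"
  "Dom (restrict_worlds U M) = Dom M"
  "eqv (restrict_worlds U M) = eqv M"
  "icst (restrict_worlds U M) = icst M"
  "iprd (restrict_worlds U M) = iprd M"
  by (simp_all add: restrict_worlds_def)

lemma val_restrict_worlds: "val (restrict_worlds U M) g t = val M g t"
  by (cases t) auto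

text \<open>Every clause moves forward along \<open>ord\<close> or \<open>acc\<close>, and
  \<open>U\<close> is closed under both, so evaluation started in \<open>U\<close> never meets a
  deleted world.\<close>

lemma sat_restrict_worlds:
  assumes up: "\<And>u v. u \<in> U \<Longrightarrow> (u, v) \<in> ord M \<union> acc M \<Longrightarrow> v \<in> U"
  shows "w \<in> U \<Longrightarrow> sat (restrict_worlds U M) w g \<phi> \<longleftrightarrow> sat M w g \<phi>"
proof (induction \<phi> arbitrary: w g)
  case (Prd P ts)
  have "val (restrict_worlds U M) g = val M g" by (simp add: fun_eq_iff val_restrict_worlds)
  then show ?case by simp
next
  case (Imp \<phi> \<psi>)
  then have "(w, v) \<in> ord M \<inter> U \<times> U \<longleftrightarrow> (w, v) \<in> ord M" for v using up by blast
  with Imp up show ?case by (auto 0 3)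
next
  case (Box \<phi>)
  \<comment> \<open>\<open>Box\<close> makes two moves, first along \<open>ord\<close> and then
    along \<open>acc\<close>, so closure is used twice.\<close>
  then have "(w, v) \<in> ord M \<inter> U \<times> U \<and> (v, u) \<in> acc M \<inter> U \<times> U \<longleftrightarrow>
      (w, v) \<in> ord M \<and> (v, u) \<in> acc M" for v u
    using up by blast
  moreover have "u \<in> U" if "(w, v) \<in> ord M" "(v, u) \<in> acc M" for v u
    using that up Box.prems by blast
  ultimately show ?case using Box.IH by (metis sat.simps(6) restrict_worlds_simps(2,3))
next
  case (Dia \<phi>)
  then have "(w, v) \<in> acc M \<Longrightarrow> v \<in> U" for v using up by blast
  with Dia show ?case by auto
next
  case (All x \<phi>)
  then have "(w, v) \<in> ord M \<inter> U \<times> U \<longleftrightarrow> (w, v) \<in> ord M" for v using up by blast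
  moreover have "sat (restrict_worlds U M) v (g(x := a)) \<phi> \<longleftrightarrow> sat M v (g(x := a)) \<phi>"
    if "(w, v) \<in> ord M" for v a
    using that up All by blast
  ultimately show ?case by (simp del: fun_upd_apply)
qed (auto simp: val_restrict_worlds)

text \<open>The worlds promised by (FC1) and (FC2) lie above worlds of \<open>U\<close>, hence in
  \<open>U\<close>. The new denotation of \<open>c\<close> must belong to every domain, which is the
  assumption on \<open>a\<close>.\<close>

lemma fofs_model_reinterpret_restrict:
  assumes M: "fofs_model \<sigma> M"
    and U: "U \<subseteq> worlds M"
    and up: "\<And>u v. u \<in> U \<Longrightarrow> (u, v) \<in> ord M \<union> acc M \<Longrightarrow> v \<in> U"
    and a: "\<And>u. u \<in> U \<Longrightarrow> a \<in> Dom M u"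
  shows "fofs_model \<sigma> (reinterpret c a (restrict_worlds U M))"
proof -
  have "partial_order_on U (ord M \<inter> U \<times> U)"
    using M U unfolding fofs_model_def fs_frame_def partial_order_on_def preorder_on_def
    by (auto simp: refl_on_def antisym_def trans_def)
  moreover have "\<exists>w'. (w, w') \<in> ord M \<inter> U \<times> U \<and> (w', v') \<in> acc M \<inter> U \<times> U"
    if "(w, v) \<in> acc M \<inter> U \<times> U" "(v, v') \<in> ord M \<inter> U \<times> U" for w v v'
  proof -
    from that obtain w' where "(w, w') \<in> ord M" "(w', v') \<in> acc M"
      using fofs_model_FC1[OF M] by blast
    with that up show ?thesis by blast
  qed
  moreover have "\<exists>v'. (v, v') \<in> ord M \<inter> U \<times> U \<and> (w', v') \<in> acc M \<inter> U \<times> U"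
    if "(w, w') \<in> ord M \<inter> U \<times> U" "(w, v) \<in> acc M \<inter> U \<times> U" for w w' v
  proof -
    from that obtain v' where "(v, v') \<in> ord M" "(w', v') \<in> acc M"
      using fofs_model_FC2[OF M] by blast
    with that up show ?thesis by blast
  qed
  ultimately have frame: "fs_frame U (ord M \<inter> U \<times> U) (acc M \<inter> U \<times> U)"
    unfolding fs_frame_def by blast
  have dom: "domain_system U (ord M \<inter> U \<times> U) (acc M \<inter> U \<times> U) (Dom M) (eqv M)"
    unfolding domain_system_def
    using fofs_model_Dom_mono[OF M] fofs_model_equiv[OF M] fofs_model_eqv_mono[OF M] U by auto
  have cst: "\<forall>d \<in> sig_cst \<sigma>. \<forall>w \<in> U. ((icst M)(c := a)) d \<in> Dom M w"
    using a U fofs_model_icst[OF M] by auto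
  have prd: "\<forall>P \<in> sig_prd \<sigma>.
     (\<forall>w \<in> U. iprd M w P \<subseteq> {as. length as = sig_ar \<sigma> P \<and> set as \<subseteq> Dom M w}) \<and>
     (\<forall>w w'. (w, w') \<in> ord M \<inter> U \<times> U \<longrightarrow> iprd M w P \<subseteq> iprd M w' P) \<and>
     (\<forall>w \<in> U. \<forall>as bs. as \<in> iprd M w P \<and> list_all2 (\<lambda>a b. (a, b) \<in> eqv M w) as bs \<longrightarrow>
        bs \<in> iprd M w P)"
  proof (intro conjI ballI allI impI)
    fix P w assume P: "P \<in> sig_prd \<sigma>" and "w \<in> U"
    then have w: "w \<in> worlds M" using U by blast
    show "iprd M w P \<subseteq> {as. length as = sig_ar \<sigma> P \<and> set as \<subseteq> Dom M w}"
      by (rule fofs_model_iprd_arity[OF M P w])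
    show "bs \<in> iprd M w P"
      if "as \<in> iprd M w P \<and> list_all2 (\<lambda>a b. (a, b) \<in> eqv M w) as bs" for as bs
      using fofs_model_iprd_eqv[OF M P w] that by blast
  next
    fix P w w' assume "P \<in> sig_prd \<sigma>" "(w, w') \<in> ord M \<inter> U \<times> U"
    then show "iprd M w P \<subseteq> iprd M w' P" using fofs_model_iprd_mono[OF M] by blast
  qed
  show ?thesis
    unfolding fofs_model_def reinterpret_simps restrict_worlds_simps
    by (intro conjI frame dom cst prd)
qed

section \<open>Soundness\<close>

lemma sat_mp: "fofs_model \<sigma> M \<Longrightarrow> w \<in> worlds M \<Longrightarrow> sat M w g (\<phi> \<^bold>\<longrightarrow> \<psi>) \<Longrightarrow> sat M w g \<phi> \<Longrightarrow>
    sat M w g \<psi>"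
  using fofs_model_ord_refl by fastforce

section \<open>Instances of intuitionistic propositional theorems\<close>

lemma wf_fm_psubst: "(\<And>i. s i \<in> sentences \<sigma>) \<Longrightarrow> wf_fm \<sigma> (psubst s p)"
  by (induction p) (auto simp: sentences_def)

text \<open>The induction runs directly on the substituted formulas, whose well-formedness makes
  persistence available. Persistence is used for \<open>ipc_K\<close> and \<open>ipc_andI\<close>,
  where an antecedent true at one world is needed at a later one; for \<open>ipc_S\<close> and
  \<open>ipc_orE\<close> the earlier implications are read at the last world by
  transitivity.\<close>

lemma ipc_sound:
  assumes M: "fofs_model \<sigma> M" and s: "\<And>i. s i \<in> sentences \<sigma>"
  shows "ipc p \<Longrightarrow> w \<in> worlds M \<Longrightarrow> sat M w g (psubst s p)"
proof (induction arbitrary: w rule: ipc.induct)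
  note persist = sat_persistent[OF M wf_fm_psubst[OF s]]
  note refl = fofs_model_ord_refl[OF M] and worlds = fofs_model_ord_worlds[OF M]
  {
    case (ipc_K p q)
    then show ?case using persist by auto
  next
    case (ipc_S p q r)
    show ?case
      unfolding psubst.simps sat.simps(5)
      using fofs_model_ord_trans[OF M] refl worlds by meson
  next
    case (ipc_andI p q)
    then show ?case using persist by auto
  next
    case (ipc_orE p r q)
    show ?case
      unfolding psubst.simps sat.simps(4,5)
      using fofs_model_ord_trans[OF M] by meson
  next
    case (ipc_mp p q)
    then show ?case using sat_mp[OF M] by (metis psubst.simps(4))
  }
qed auto

section \<open>Axioms and rules of FOFS\<close>

text \<open>The model is kept arbitrary in the induction because generalization applies the
  hypothesis to another model over the same types; the world is arbitrary because the
  \<open>Box\<close> and \<open>Dia\<close> rules apply it at successors.\<close>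

lemma fofs_sound:
  fixes M :: "('w, 'd, 'c, 'p) model"
  shows "fofs \<sigma> \<phi> \<Longrightarrow> fofs_model \<sigma> M \<Longrightarrow> w \<in> worlds M \<Longrightarrow> sat M w g \<phi>"
proof (induction arbitrary: M w g rule: fofs.induct)
  case (ax_ipc p s)
  then show ?case by (intro ipc_sound)
next
  case (ax_box_and \<phi> \<psi>)
  then show ?case by auto
next
  case ax_box_top
  then show ?case by auto
next
  case (ax_dia_or \<phi> \<psi>)
  then show ?case by auto
next
  case ax_dia_bot
  then show ?case by auto
next
  case (ax_FS1 \<phi> \<psi>)
  note M = ax_FS1.prems(1)
  \<comment> \<open>By (FC1), the path from \<open>w2\<close> through \<open>v2\<close> up to
    \<open>v3\<close> is completed by some \<open>w3\<close> above \<open>w2\<close> that sees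
    \<open>v3\<close>. Then \<open>Dia \<phi>\<close> holds at \<open>w3\<close>, so
    \<open>Box \<psi>\<close> does too, and this returns to \<open>v3\<close>.\<close>
  have "sat M v3 g \<psi>"
    if "sat M w1 g (Dia \<phi> \<^bold>\<longrightarrow> Box \<psi>)" "(w1, w2) \<in> ord M" "(w2, v2) \<in> acc M"
      "(v2, v3) \<in> ord M" "sat M v3 g \<phi>" for w1 w2 v2 v3
  proof -
    from that obtain w3 where w3: "(w2, w3) \<in> ord M" "(w3, v3) \<in> acc M"
      using fofs_model_FC1[OF M] by metis
    moreover have "(w1, w3) \<in> ord M" using that w3 fofs_model_ord_trans[OF M] by metis
    ultimately have "sat M w3 g (Box \<psi>)" using that by auto
    moreover have "(w3, w3) \<in> ord M"
      using w3 fofs_model_ord_refl[OF M] fofs_model_ord_worlds[OF M] by metis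
    ultimately show ?thesis using w3 by auto
  qed
  then show ?case by (simp only: sat.simps(5,6)) blast
next
  case (ax_FS2 \<phi> \<psi>)
  note M = ax_FS2.prems(1)
  have wf: "wf_fm \<sigma> (Dia (\<phi> \<^bold>\<longrightarrow> \<psi>))" using ax_FS2.hyps by (simp add: sentences_def)
  have "sat M w2 g (Dia \<psi>)"
    if "sat M w1 g (Dia (\<phi> \<^bold>\<longrightarrow> \<psi>))" "(w1, w2) \<in> ord M" "sat M w2 g (Box \<phi>)" for w1 w2
  proof -
    \<comment> \<open>The diamond is given at \<open>w1\<close> but the box at \<open>w2\<close>;
      persistence brings both to \<open>w2\<close>, so that one successor \<open>v\<close> serves
      for both.\<close>
    have "sat M w2 g (Dia (\<phi> \<^bold>\<longrightarrow> \<psi>))" using sat_persistent[OF M wf] that by blast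
    then obtain v where v: "(w2, v) \<in> acc M" "sat M v g (\<phi> \<^bold>\<longrightarrow> \<psi>)" by auto
    moreover have "(w2, w2) \<in> ord M"
      using that fofs_model_ord_refl[OF M] fofs_model_ord_worlds[OF M] by blast
    with v that have "sat M v g \<phi>" by auto
    ultimately show ?thesis
      using sat_mp[OF M] fofs_model_acc_worlds[OF M] by auto
  qed
  then show ?case by (simp only: sat.simps(5)) blast
next
  case (ax_allE x \<phi> c)
  note M = ax_allE.prems(1)
  show ?case
    using fofs_model_ord_worlds[OF M] fofs_model_ord_refl[OF M]
      fofs_model_icst[OF M ax_allE.hyps(2)]
    unfolding sat_inst sat.simps by blast
next
  case (ax_exI x \<phi> c)
  note M = ax_exI.prems(1)
  show ?case
    using ax_exI.hyps fofs_model_ord_worlds[OF M] fofs_model_icst[OF M]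
    by (auto simp: sat_inst)
next
  case (ax_all_ex x \<phi> \<psi>)
  note M = ax_all_ex.prems(1)
  have "sat M w2 g \<psi>"
    if "sat M w1 g (All x (\<phi> \<^bold>\<longrightarrow> \<psi>))" "(w1, w2) \<in> ord M" "sat M w2 g (Exi x \<phi>)" for w1 w2
  proof -
    from that obtain a where a: "a \<in> Dom M w2" "sat M w2 (g(x := a)) \<phi>" by auto
    then have "sat M w2 (g(x := a)) (\<phi> \<^bold>\<longrightarrow> \<psi>)" using that by (auto simp del: sat.simps(5))
    then have "sat M w2 (g(x := a)) \<psi>"
      using sat_mp[OF M] a that fofs_model_ord_worlds[OF M] by metis
    then show ?thesis by (simp add: sat_fun_upd_sentence[OF ax_all_ex.hyps(2)])
  qed
  then show ?case by (simp only: sat.simps(5)) blast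
next
  case (ax_all_imp \<phi> x \<psi>)
  note M = ax_all_imp.prems(1)
  have wf: "wf_fm \<sigma> \<phi>" using ax_all_imp.hyps by (simp add: sentences_def)
  have "sat M w3 (g(x := a)) \<psi>"
    if "sat M w1 g (All x (\<phi> \<^bold>\<longrightarrow> \<psi>))" "(w1, w2) \<in> ord M" "sat M w2 g \<phi>"
      "(w2, w3) \<in> ord M" "a \<in> Dom M w3" for w1 w2 w3 a
  proof -
    have "(w1, w3) \<in> ord M" using that fofs_model_ord_trans[OF M] by metis
    then have "sat M w3 (g(x := a)) (\<phi> \<^bold>\<longrightarrow> \<psi>)" using that by (auto simp del: sat.simps(5))
    \<comment> \<open>\<open>\<phi>\<close> is known at \<open>w2\<close> under \<open>g\<close>:
      persistence changes the world, and being a sentence allows the change of assignment.\<close>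
    moreover have "sat M w3 (g(x := a)) \<phi>"
      using sat_persistent[OF M wf] that by (auto simp: sat_fun_upd_sentence[OF ax_all_imp.hyps(1)])
    ultimately show ?thesis
      using sat_mp[OF M] that fofs_model_ord_worlds[OF M] by metis
  qed
  then show ?case by (simp only: sat.simps(5,8)) blast
next
  case (ax_refl c)
  then show ?case by (auto intro!: fofs_model_eqv_refl fofs_model_icst)
next
  case (ax_leibniz x \<phi> c1 c2)
  note M = ax_leibniz.prems(1)
  have "sat M w2 (g(x := icst M c2)) \<phi>"
    if "(icst M c1, icst M c2) \<in> eqv M w1" "(w1, w2) \<in> ord M"
      "sat M w2 (g(x := icst M c1)) \<phi>" for w1 w2
  proof -
    have "(icst M c1, icst M c2) \<in> eqv M w2"
      using that fofs_model_eqv_mono[OF M] by blast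
    \<comment> \<open>The only free variable is \<open>x\<close>, and its two values are equivalent
      at \<open>w2\<close>, the world where truth is compared.\<close>
    then have "sat M w2 (g(x := icst M c1)) \<phi> \<longleftrightarrow> sat M w2 (g(x := icst M c2)) \<phi>"
      using ax_leibniz.hyps that fofs_model_ord_worlds[OF M]
      by (intro sat_eqv_modal_free[OF M]) (auto simp: one_place_def)
    with that show ?thesis by blast
  qed
  then show ?case by (auto simp: sat_inst)
next
  case (rule_mp \<phi> \<psi>)
  then show ?case by (intro sat_mp[OF rule_mp.prems rule_mp.IH(2) rule_mp.IH(1)])
next
  case (rule_gen \<phi> c x)
  note M = rule_gen.prems(1)
  have "sat M w' (g(x := a)) (repl c x \<phi>)" if w': "(w, w') \<in> ord M" and a: "a \<in> Dom M w'" for w' a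
  proof -
    \<comment> \<open>The generating world is \<open>w'\<close> and not \<open>w\<close>, since
      \<open>a\<close> is only known to lie in \<open>Dom M w'\<close>.\<close>
    define U where "U = {u. (w', u) \<in> (ord M \<union> acc M)\<^sup>*}"
    have up: "v \<in> U" if "u \<in> U" "(u, v) \<in> ord M \<union> acc M" for u v
      using that unfolding U_def by (auto intro: rtrancl_into_rtrancl)
    have *: "u \<in> worlds M \<and> a \<in> Dom M u" if "u \<in> U" for u
    proof -
      from that have "(w', u) \<in> (ord M \<union> acc M)\<^sup>*" by (simp add: U_def)
      then show ?thesis
      proof induction
        case base
        show ?case using w' a fofs_model_ord_worlds[OF M] by blast
      next
        case (step y z)
        then show ?case
          using fofs_model_ord_worlds[OF M] fofs_model_acc_worlds[OF M] fofs_model_Dom_mono[OF M]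
          by blast
      qed
    qed
    let ?N = "reinterpret c a (restrict_worlds U M)"
    have "w' \<in> U" by (simp add: U_def)
    have "fofs_model \<sigma> ?N"
      using * by (intro fofs_model_reinterpret_restrict[OF M _ up]) auto
    \<comment> \<open>The induction hypothesis is used in \<open>?N\<close>, where \<open>c\<close>
      denotes \<open>a\<close>; \<open>sat_repl\<close> then trades this denotation for the value of
      \<open>x\<close>, and the restriction is undone last.\<close>
    then have "sat ?N w' (g(x := a)) \<phi>" using rule_gen.IH \<open>w' \<in> U\<close> by simp
    then have "sat (restrict_worlds U M) w' (g(x := a)) (repl c x \<phi>)"
      by (subst sat_repl[OF rule_gen.hyps(3) fun_upd_same])
    then show ?thesis using sat_restrict_worlds[of U M w'] up \<open>w' \<in> U\<close> by blast
  qed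
  then show ?case by simp
next
  case (rule_box \<phi> \<psi>)
  note M = rule_box.prems(1)
  have "sat M v g \<psi>"
    if "sat M w1 g (Box \<phi>)" "(w1, w2) \<in> ord M" "(w2, v) \<in> acc M" for w1 w2 v
    using that sat_mp[OF M] rule_box.IH[OF M] fofs_model_acc_worlds[OF M]
    by (metis sat.simps(6))
  then show ?case by (simp only: sat.simps(5,6)) blast
next
  case (rule_dia \<phi> \<psi>)
  note M = rule_dia.prems(1)
  have "sat M w1 g (Dia \<psi>)" if "sat M w1 g (Dia \<phi>)" for w1
    using that sat_mp[OF M] rule_dia.IH[OF M] fofs_model_acc_worlds[OF M]
    by (metis sat.simps(7))
  then show ?case by (simp only: sat.simps(5)) blast
qed

section \<open>Derivations from premises\<close>

lemma sat_big_and: "\<forall>\<gamma> \<in> set \<gamma>s. sat M w g \<gamma> \<Longrightarrow> sat M w g (big_and \<gamma>s)"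
  by (induction \<gamma>s rule: big_and.induct) auto

theorem mainTheorem2:
  fixes \<sigma> :: "('c, 'p) signature"
    and \<Gamma> :: "('c, 'p) fm set"
    and \<phi> :: "('c, 'p) fm"
  assumes "is_signature \<sigma>"
    and "\<Gamma> \<subseteq> sentences \<sigma>"
    and "\<phi> \<in> sentences \<sigma>"
    and "fofs_derives \<sigma> \<Gamma> \<phi>"
  shows "fofs_entails TYPE('w) TYPE('d) \<sigma> \<Gamma> \<phi>"
  unfolding fofs_entails_def holds_def
proof (intro allI ballI impI)
  fix M :: "('w, 'd, 'c, 'p) model" and w and g :: "nat \<Rightarrow> 'd"
  assume M: "fofs_model \<sigma> M" and w: "w \<in> worlds M" and g: "range g \<subseteq> Dom M w"
    and \<Gamma>: "\<forall>\<gamma>\<in>\<Gamma>. \<forall>g. range g \<subseteq> Dom M w \<longrightarrow> sat M w g \<gamma>"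
  obtain \<gamma>s where \<gamma>s: "set \<gamma>s \<subseteq> \<Gamma>" "fofs \<sigma> (big_and \<gamma>s \<^bold>\<longrightarrow> \<phi>)"
    using assms(4) by (auto simp: fofs_derives_def)
  \<comment> \<open>The premises are true under all assignments into \<open>Dom M w\<close>, in
    particular under the fixed \<open>g\<close> for which \<open>\<phi>\<close> is to be
    shown.\<close>
  have "sat M w g (big_and \<gamma>s)"
    using \<gamma>s(1) \<Gamma> g by (intro sat_big_and) blast
  then show "sat M w g \<phi>"
    using sat_mp[OF M w] fofs_sound[OF \<gamma>s(2) M w] by blast
qed

end
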